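(* There is a constant $c>0$ such that for infinitely many positive integers $g$, there exists a graph of girth at least $7$ embeddable on a surface of Euler genus $g$ that has no $(0,\lfloor c\sqrt{g}\rfloor)$-coloring.
   Context: All graphs are finite and simple (no loops, no multiple edges). For integers $d_1,\ldots,d_k$, a $(d_1,\ldots,d_k)$-coloring of a graph $G$ is an assignment to each vertex of a color from $\{1,\ldots,k\}$ such that for each $i$, every vertex colored $i$ has at most $d_i$ neighbors colored $i$. Girth at least $7$ means that the graph has no cycle of length less than $7$. A surface is a non-null compact connected 2-manifold without boundary. The Euler genus of a surface is $2h$ if it is the orientable surface obtained from the sphere by adding $h\ge 0$ handles, and $k$ if it is the non-orientable surface obtained from the sphere by adding $k\ge 1$ cross-caps. *)

theory Defs
  imports "HOL-Analysis.Analysis"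
begin

section \<open>Graphs, girth and improper colorings\<close>

definition simple_graph :: "'a set \<Rightarrow> 'a set set \<Rightarrow> bool" where
  "simple_graph V E \<longleftrightarrow> finite V \<and> E \<subseteq> {{u, v} | u v. u \<in> V \<and> v \<in> V \<and> u \<noteq> v}"

definition graph_cycle :: "'a set set \<Rightarrow> 'a list \<Rightarrow> bool" where
  "graph_cycle E xs \<longleftrightarrow> 3 \<le> length xs \<and> distinct xs \<and>
     (\<forall>i<length xs. {xs ! i, xs ! (Suc i mod length xs)} \<in> E)"

text \<open>Forests have girth at least every n.\<close>

definition girth_at_least :: "nat \<Rightarrow> 'a set set \<Rightarrow> bool" where
  "girth_at_least n E \<longleftrightarrow> \<not> (\<exists>xs. graph_cycle E xs \<and> length xs < n)"

text \<open>
  The list \<open>ds\<close> holds the defects of the colors; colors are numbered from 0, so that the color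
  \<open>i\<close> of the mathematical text is the number \<open>i - 1\<close> here.
\<close>

definition improper_coloring ::
  "int list \<Rightarrow> 'a set \<Rightarrow> 'a set set \<Rightarrow> ('a \<Rightarrow> nat) \<Rightarrow> bool" where
  "improper_coloring ds V E col \<longleftrightarrow>
     (\<forall>v\<in>V. col v < length ds \<and>
        int (card {u \<in> V. {u, v} \<in> E \<and> col u = col v}) \<le> ds ! col v)"

section \<open>Surfaces\<close>

text \<open>
  Second countability is not listed: it follows from compactness and the existence of charts.
\<close>

definition surface :: "'s topology \<Rightarrow> bool" where
  "surface S \<longleftrightarrow> topspace S \<noteq> {} \<and> compact_space S \<and> connected_space S \<and> Hausdorff_space S \<and>
     (\<forall>x\<in>topspace S. \<exists>U (W :: complex set). openin S U \<and> x \<in> U \<and> open W \<and>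
        subtopology S U homeomorphic_space top_of_set W)"

text \<open>
  The sphere is taken to be the Riemann sphere, the one-point compactification of the plane.
  Handles and cross-caps are added in pairwise disjoint closed round discs of the plane. The open
  discs are removed from the sphere. For a handle, the boundary circles of two of the removed
  discs are identified by an orientation-reversing map (a mirror reflection followed by a similarity
  \<open>z \<mapsto> p * z + q\<close> with \<open>p > 0\<close>); a cylinder inserted between the two circles would give a
  homeomorphic space. Because all discs lie in one oriented plane, this is what keeps
  the surface orientable. For a cross-cap, diametrically opposite points of the boundary circle of
  one removed disc are identified.
\<close>

abbreviation riemann_sphere :: "complex option topology" where
  "riemann_sphere \<equiv> Alexandroff_compactification euclidean"

definition disjoint_discs :: "nat \<Rightarrow> (nat \<Rightarrow> complex) \<Rightarrow> (nat \<Rightarrow> real) \<Rightarrow> bool" where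
  "disjoint_discs n c r \<longleftrightarrow> (\<forall>i<n. 0 < r i) \<and>
     (\<forall>i<n. \<forall>j<n. i \<noteq> j \<longrightarrow> cball (c i) (r i) \<inter> cball (c j) (r j) = {})"

definition holed_sphere :: "nat \<Rightarrow> (nat \<Rightarrow> complex) \<Rightarrow> (nat \<Rightarrow> real) \<Rightarrow> complex option set" where
  "holed_sphere n c r = UNIV - Some ` (\<Union>i<n. ball (c i) (r i))"

text \<open>The \<open>i\<close>-th handle joins the discs numbered \<open>2 * i\<close> and \<open>2 * i + 1\<close>.\<close>

definition handle_pair ::
  "nat \<Rightarrow> (nat \<Rightarrow> complex) \<Rightarrow> (nat \<Rightarrow> real) \<Rightarrow> complex option \<Rightarrow> complex option \<Rightarrow> bool" where
  "handle_pair h c r x y \<longleftrightarrow> (\<exists>i<h. \<exists>w. cmod w = 1 \<and>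
     x = Some (c (2 * i) + of_real (r (2 * i)) * w) \<and>
     y = Some (c (2 * i + 1) - of_real (r (2 * i + 1)) * cnj w))"

definition crosscap_pair ::
  "nat \<Rightarrow> (nat \<Rightarrow> complex) \<Rightarrow> (nat \<Rightarrow> real) \<Rightarrow> complex option \<Rightarrow> complex option \<Rightarrow> bool" where
  "crosscap_pair k c r x y \<longleftrightarrow> (\<exists>i<k. \<exists>w. cmod w = 1 \<and>
     x = Some (c i + of_real (r i) * w) \<and>
     y = Some (c i - of_real (r i) * w))"

text \<open>
  A space is homeomorphic to the quotient of \<open>X\<close> by an equivalence relation iff it is the target
  of a quotient map on \<open>X\<close> whose fibers are the equivalence classes. The two predicates below are
  therefore invariant under homeomorphism.
\<close>

definition sphere_with_handles :: "nat \<Rightarrow> 's topology \<Rightarrow> bool" where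
  "sphere_with_handles h S \<longleftrightarrow> (\<exists>c r q. disjoint_discs (2 * h) c r \<and>
     quotient_map (subtopology riemann_sphere (holed_sphere (2 * h) c r)) S q \<and>
     (\<forall>x\<in>holed_sphere (2 * h) c r. \<forall>y\<in>holed_sphere (2 * h) c r.
        q x = q y \<longleftrightarrow> x = y \<or> handle_pair h c r x y \<or> handle_pair h c r y x))"

definition sphere_with_crosscaps :: "nat \<Rightarrow> 's topology \<Rightarrow> bool" where
  "sphere_with_crosscaps k S \<longleftrightarrow> (\<exists>c r q. disjoint_discs k c r \<and>
     quotient_map (subtopology riemann_sphere (holed_sphere k c r)) S q \<and>
     (\<forall>x\<in>holed_sphere k c r. \<forall>y\<in>holed_sphere k c r.
        q x = q y \<longleftrightarrow> x = y \<or> crosscap_pair k c r x y))"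

definition has_euler_genus :: "'s topology \<Rightarrow> nat \<Rightarrow> bool" where
  "has_euler_genus S g \<longleftrightarrow>
     (\<exists>h. g = 2 * h \<and> sphere_with_handles h S) \<or> (g \<ge> 1 \<and> sphere_with_crosscaps g S)"

section \<open>Graphs embedded in a topological space\<close>

text \<open>
  An embedding draws the vertices as distinct points and the edges as simple arcs between their
  ends; an arc meets the vertices and the other arcs only in its ends. It need not be cellular.
\<close>

definition graph_embedding ::
  "'a set \<Rightarrow> 'a set set \<Rightarrow> 's topology \<Rightarrow> ('a \<Rightarrow> 's) \<Rightarrow> ('a set \<Rightarrow> real \<Rightarrow> 's) \<Rightarrow> bool" where
  "graph_embedding V E S p \<gamma> \<longleftrightarrow>
     p ` V \<subseteq> topspace S \<and> inj_on p V \<and>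
     (\<forall>e\<in>E. pathin S (\<gamma> e) \<and> inj_on (\<gamma> e) {0..1} \<and> {\<gamma> e 0, \<gamma> e 1} = p ` e \<and>
        \<gamma> e ` {0<..<1} \<inter> p ` V = {}) \<and>
     (\<forall>e\<in>E. \<forall>f\<in>E. e \<noteq> f \<longrightarrow> \<gamma> e ` {0<..<1} \<inter> \<gamma> f ` {0<..<1} = {})"

definition embeddable :: "'a set \<Rightarrow> 'a set set \<Rightarrow> 's topology \<Rightarrow> bool" where
  "embeddable V E S \<longleftrightarrow> (\<exists>p \<gamma>. graph_embedding V E S p \<gamma>)"

text \<open>
  The points of the surface are taken from \<^typ>\<open>complex option\<close>, with an arbitrary topology.
  This is no restriction, as every surface has as many points as this type; likewise every finite
  graph is isomorphic to one with vertices in \<^typ>\<open>nat\<close>.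
\<close>

definition embeddable_in_genus :: "nat set \<Rightarrow> nat set set \<Rightarrow> nat \<Rightarrow> bool" where
  "embeddable_in_genus V E g \<longleftrightarrow>
     (\<exists>S :: complex option topology. surface S \<and> has_euler_genus S g \<and> embeddable V E S)"

end

(*
  The graph. Join the sets X and Y of 3k+3 vertices by once subdivided edges and the pairs in X by
  twice subdivided edges; a short cycle would need two edges between the same ends or a triangle in
  a bipartite graph, so the girth is at least 7. In a (0,k)-coloring a vertex of X with color 2 has
  at most k neighbors across in Y with color 1, and conversely; so either X and Y are entirely
  colored 1 or each contains at most k vertices of color 1. In the latter case the twice subdivided
  edges force more than k|B| conflicts on the set B of vertices of X with color 2. An
  edge between two copies of the graph excludes that both copies are in the former case.

  The surface. A graph with m edges embeds in the sphere with m handles, as each edge can use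
  a handle of its own. Here m is quadratic in k.
*)
theory Submission
  imports Defs
begin

section \<open>Spheres with handles\<close>

text \<open>No genus has to be minimal and no embedding cellular, so the combinatorics of faces
  never enters. The price is point-set topology: the sphere with handles must be exhibited as a
  compact Hausdorff space with charts, on a prescribed carrier type. Equal unit discs with real
  centres keep every gluing map explicit, and representatives in place of equivalence classes keep
  the carrier. The two subdivision numbers are tuned to each other: two vertices of X and one of Y
  span a cycle of length 3 + 2 + 2 = 7. The size 3k + 3 comes from the count on B: at most k
  vertices of X have color 1, so |B| \<ge> 2k + 3, while the |B|(|B| - 1)/2 twice subdivided edges
  inside B exceed k|B| as soon as |B| > 2k + 1.\<close>

lemma local_chart:
  assumes "Hausdorff_space S" "compact K" "W \<subseteq> K" "continuous_map (top_of_set K) S f" "inj_on f K"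
  shows "subtopology S (f ` W) homeomorphic_space top_of_set W"
proof -
  \<comment> \<open>An injection of a compact space into a Hausdorff space is an embedding, so no
    continuous inverse has to be exhibited.\<close>
  have "embedding_map (top_of_set K) S f"
    using assms by (intro continuous_imp_embedding_map) (auto simp: compact_space_subtopology)
  then have "homeomorphic_map (top_of_set K) (subtopology S (f ` K)) f"
    by (simp add: embedding_map_def)
  moreover have "f ` K \<subseteq> topspace S"
    using continuous_map_image_subset_topspace[OF assms(4)] by simp
  then have "f ` (topspace (top_of_set K) \<inter> W) = topspace (subtopology S (f ` K)) \<inter> f ` W"
    using assms(3) by auto
  ultimately have "homeomorphic_map (subtopology (top_of_set K) W)
      (subtopology (subtopology S (f ` K)) (f ` W)) f"
    by (rule homeomorphic_map_subtopologies)
  moreover have "K \<inter> W = W" "f ` K \<inter> f ` W = f ` W"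
    using assms(3) by auto
  ultimately have "homeomorphic_map (top_of_set W) (subtopology S (f ` W)) f"
    by (simp add: subtopology_subtopology)
  then show ?thesis
    using homeomorphic_map_imp_homeomorphic_space homeomorphic_space_sym by blast
qed

text \<open>The points are values of \<open>q\<close> rather than equivalence classes: a
  \<open>q\<close> that selects representatives keeps the surface inside
  \<open>complex option\<close>, as \<open>embeddable_in_genus\<close> demands.\<close>

definition quotient_space :: "'a topology \<Rightarrow> ('a \<Rightarrow> 'b) \<Rightarrow> 'b topology" where
  "quotient_space X q =
     topology (\<lambda>U. U \<subseteq> q ` topspace X \<and> openin X {x \<in> topspace X. q x \<in> U})"

lemma openin_quotient_space:
  "openin (quotient_space X q) U \<longleftrightarrow>
     U \<subseteq> q ` topspace X \<and> openin X {x \<in> topspace X. q x \<in> U}"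
proof -
  have "istopology (\<lambda>U. U \<subseteq> q ` topspace X \<and> openin X {x \<in> topspace X. q x \<in> U})"
    unfolding istopology_def
  proof (intro conjI allI impI)
    fix S T
    assume "S \<subseteq> q ` topspace X \<and> openin X {x \<in> topspace X. q x \<in> S}"
      and "T \<subseteq> q ` topspace X \<and> openin X {x \<in> topspace X. q x \<in> T}"
    moreover have "{x \<in> topspace X. q x \<in> S \<inter> T} =
        {x \<in> topspace X. q x \<in> S} \<inter> {x \<in> topspace X. q x \<in> T}"
      by auto
    ultimately show "S \<inter> T \<subseteq> q ` topspace X" "openin X {x \<in> topspace X. q x \<in> S \<inter> T}"
      by (auto intro: openin_Int)
  next
    fix K
    assume *: "\<forall>S\<in>K. S \<subseteq> q ` topspace X \<and> openin X {x \<in> topspace X. q x \<in> S}"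
    then show "\<Union> K \<subseteq> q ` topspace X" by blast
    have "{x \<in> topspace X. q x \<in> \<Union> K} = (\<Union>S\<in>K. {x \<in> topspace X. q x \<in> S})"
      by auto
    then show "openin X {x \<in> topspace X. q x \<in> \<Union> K}"
      using * by auto
  qed
  then show ?thesis
    by (simp add: quotient_space_def)
qed

lemma topspace_quotient_space [simp]: "topspace (quotient_space X q) = q ` topspace X"
proof -
  have "openin (quotient_space X q) (q ` topspace X)"
    unfolding openin_quotient_space by (auto intro: openin_subopen[THEN iffD2])
  then show ?thesis
    by (metis openin_quotient_space openin_subset openin_topspace subset_antisym)
qed

lemma quotient_map_quotient_space: "quotient_map X (quotient_space X q) q"
  by (auto simp: quotient_map_def openin_quotient_space)

section \<open>Gluing the boundary circles: involution, compactness, separation\<close>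

text \<open>\<open>mate j\<close> is the disc that a handle joins to the disc \<open>j\<close>.\<close>

definition mate :: "nat \<Rightarrow> nat" where
  "mate j = (if even j then Suc j else j - 1)"

lemma mate_less: "j < 2 * h \<Longrightarrow> mate j < 2 * h"
  by (auto simp: mate_def elim!: evenE)

lemma mate_mate [simp]: "mate (mate j) = j"
  by (auto simp: mate_def elim!: oddE)

lemma mate_neq: "mate j \<noteq> j"
  by (auto simp: mate_def elim!: oddE)

lemma mate_double [simp]: "mate (2 * i) = Suc (2 * i)" "mate (Suc (2 * i)) = 2 * i"
  by (auto simp: mate_def)

text \<open>Distance 5 leaves room for a collar out to radius 2 around each unit disc, whose points
  are still at distance at least 3 from every other centre. Real centres leave the open lower half
  plane free of centres for the drawing of the graph.\<close>

locale handle_discs =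
  fixes h :: nat and c :: "nat \<Rightarrow> complex"
  assumes centre_real: "j < 2 * h \<Longrightarrow> Im (c j) = 0"
    and centre_dist: "\<lbrakk>i < 2 * h; j < 2 * h; i \<noteq> j\<rbrakk> \<Longrightarrow> 5 \<le> dist (c i) (c j)"
begin

text \<open>
  \<open>flip j\<close> is the gluing map from the boundary circle of disc \<open>j\<close> to that of disc \<open>mate j\<close>; with
  unit radii one formula serves both directions. \<open>opp\<close> is the resulting involution, the
  identity off the circles, and \<open>glue\<close> picks one point of each orbit \<open>{x, opp x}\<close>.
\<close>

definition flip :: "nat \<Rightarrow> complex \<Rightarrow> complex" where
  "flip j z = c (mate j) - cnj (z - c j)"

definition opp :: "complex option \<Rightarrow> complex option" where
  "opp x = (case x of None \<Rightarrow> None | Some z \<Rightarrow>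
     if \<exists>j<2 * h. cmod (z - c j) = 1 then Some (flip (SOME j. j < 2 * h \<and> cmod (z - c j) = 1) z)
     else Some z)"

definition glue :: "complex option \<Rightarrow> complex option" where
  "glue x = (SOME y. y = x \<or> y = opp x)"

abbreviation holed :: "complex option set" where
  "holed \<equiv> holed_sphere (2 * h) c (\<lambda>_. 1)"

abbreviation holed_top :: "complex option topology" where
  "holed_top \<equiv> subtopology riemann_sphere holed"

abbreviation glued :: "complex option topology" where
  "glued \<equiv> quotient_space holed_top glue"

lemma near_unique:
  assumes "i < 2 * h" "j < 2 * h" "cmod (z - c i) \<le> 2" "cmod (z - c j) < 3"
  shows "i = j"
proof (rule ccontr)
  assume "i \<noteq> j"
  with centre_dist assms have "5 \<le> dist (c i) (c j)" by blast
  also have "\<dots> \<le> dist z (c i) + dist z (c j)"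
    by (metis dist_commute dist_triangle)
  finally show False using assms by (simp add: dist_norm)
qed

lemma Some_in_holed: "Some z \<in> holed \<longleftrightarrow> (\<forall>j<2 * h. 1 \<le> cmod (z - c j))"
  by (auto simp: holed_sphere_def dist_norm norm_minus_commute not_less image_iff)

lemma None_in_holed: "None \<in> holed"
  by (auto simp: holed_sphere_def)

lemma topspace_holed [simp]: "topspace holed_top = holed"
  using not_None_eq by (auto simp: holed_sphere_def)

lemma flip_circle:
  assumes "cmod (z - c j) = 1"
  shows "cmod (flip j z - c (mate j)) = 1"
  using assms by (simp add: flip_def del: complex_cnj_diff)

lemma flip_flip: "flip (mate j) (flip j z) = z"
  by (simp add: flip_def)

lemma opp_None [simp]: "opp None = None"
  by (simp add: opp_def)

lemma opp_circle:
  assumes "j < 2 * h" "cmod (z - c j) = 1"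
  shows "opp (Some z) = Some (flip j z)"
proof -
  have "i = j" if "i < 2 * h \<and> cmod (z - c i) = 1" for i
    using near_unique[of i j z] that assms by simp
  then have "(SOME j. j < 2 * h \<and> cmod (z - c j) = 1) = j"
    using assms by (intro some_equality) blast+
  moreover have "\<exists>j<2 * h. cmod (z - c j) = 1"
    using assms by blast
  ultimately show ?thesis by (simp add: opp_def)
qed

lemma opp_off_circle:
  assumes "\<And>j. j < 2 * h \<Longrightarrow> cmod (z - c j) \<noteq> 1"
  shows "opp (Some z) = Some z"
  using assms by (auto simp: opp_def)

lemma opp_cases:
  obtains "x = None" "opp x = None"
  | z where "x = Some z" "opp x = Some z" "\<And>j. j < 2 * h \<Longrightarrow> cmod (z - c j) \<noteq> 1"
  | z j where "x = Some z" "j < 2 * h" "cmod (z - c j) = 1" "opp x = Some (flip j z)"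
  by (cases x) (use opp_off_circle opp_circle in force)+

lemma opp_opp: "opp (opp x) = x"
proof (cases x rule: opp_cases)
  case (3 z j)
  then show ?thesis
    using opp_circle[OF mate_less[OF 3(2)] flip_circle[OF 3(3)]] flip_flip[of j z] by simp
qed auto

lemma opp_holed: "x \<in> holed \<Longrightarrow> opp x \<in> holed"
proof (cases x rule: opp_cases)
  case (3 z j)
  have "1 \<le> cmod (flip j z - c i)" if "i < 2 * h" for i
    using near_unique[OF that mate_less[OF 3(2)], of "flip j z"] flip_circle[OF 3(3)] by fastforce
  then show ?thesis using 3 by (simp add: Some_in_holed)
qed auto

lemma glue_cases: "glue x = x \<or> glue x = opp x"
  unfolding glue_def by (rule someI[of _ x]) simp

lemma glue_eq_iff: "glue x = glue y \<longleftrightarrow> x = y \<or> x = opp y"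
proof
  assume "glue x = glue y"
  then show "x = y \<or> x = opp y"
    by (metis glue_cases opp_opp)
next
  assume *: "x = y \<or> x = opp y"
  \<comment> \<open>\<open>SOME\<close> depends only on the predicate, and since \<open>opp\<close>
    is an involution, both points of an orbit give the same one.\<close>
  then have "(\<lambda>u. u = x \<or> u = opp x) = (\<lambda>u. u = y \<or> u = opp y)"
    using opp_opp by auto
  then show "glue x = glue y"
    by (simp add: glue_def)
qed

lemma glue_opp: "glue (opp x) = glue x"
  by (simp add: glue_eq_iff)

lemma quotient_glue: "quotient_map holed_top glued glue"
  by (rule quotient_map_quotient_space)

lemma continuous_glue: "continuous_map holed_top glued glue"
  using quotient_glue quotient_imp_continuous_map by blast

lemma Hausdorff_riemann_sphere: "Hausdorff_space riemann_sphere"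
  by (simp add: Hausdorff_space_Alexandroff_compactification locally_compact_space_euclidean)

lemma compact_holed: "compact_space holed_top"
proof -
  have "openin riemann_sphere (Some ` (\<Union>i<2 * h. ball (c i) 1))"
    by (subst openin_Alexandroff_compactification_image_Some) auto
  moreover have "topspace riemann_sphere - holed = Some ` (\<Union>i<2 * h. ball (c i) 1)"
    by (auto simp: holed_sphere_def)
  moreover have "holed \<subseteq> topspace riemann_sphere"
    using notin_range_Some by auto
  ultimately have "closedin riemann_sphere holed"
    by (simp only: closedin_def)
  then show ?thesis
    by (simp add: closedin_compact_space compact_space_subtopology)
qed

lemma Hausdorff_holed: "Hausdorff_space holed_top"
  using Hausdorff_riemann_sphere by (rule Hausdorff_space_subtopology)

text \<open>
  The saturation of a closed set adds only the images of its traces on the finitely many circles,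
  which are compact. As a closed image of a normal space, the quotient is then Hausdorff.
\<close>

lemma closed_glue: "closed_map holed_top glued glue"
proof -
  have "closedin holed_top {x \<in> holed. glue x \<in> glue ` C}" if C: "closedin holed_top C" for C
  proof -
    have "C \<subseteq> holed" using closedin_subset[OF C] by simp
    define D where "D j = Some ` flip j ` {z. cmod (z - c j) = 1 \<and> Some z \<in> C}" for j
    have "closedin holed_top (D j)" if j: "j < 2 * h" for j
    proof -
      have "closedin riemann_sphere C"
      proof -
        have "compactin riemann_sphere C"
          using C compact_holed by (metis closedin_compact_space compactin_subtopology)
        then show ?thesis using Hausdorff_riemann_sphere compactin_imp_closedin by blast
      qed
      then have "closed {z. Some z \<in> C}"
        using closedin_continuous_map_preimage[OF continuous_map_Some[of euclidean], of C] by simp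
      then have "compact (sphere (c j) 1 \<inter> {z. Some z \<in> C})"
        by (intro compact_Int_closed) auto
      moreover have "continuous_on A (flip j)" for A
        unfolding flip_def by (intro continuous_intros)
      ultimately have "compact (flip j ` (sphere (c j) 1 \<inter> {z. Some z \<in> C}))"
        by (intro compact_continuous_image)
      moreover have "sphere (c j) 1 \<inter> {z. Some z \<in> C} = {z. cmod (z - c j) = 1 \<and> Some z \<in> C}"
        by (auto simp: dist_norm norm_minus_commute)
      ultimately have "closedin riemann_sphere (D j)"
        unfolding D_def by (subst closedin_Alexandroff_compactification_image_Some) (auto intro: compact_imp_closed)
      moreover have "D j \<subseteq> holed"
      proof
        fix x assume "x \<in> D j"
        then obtain z where z: "x = Some (flip j z)" "cmod (z - c j) = 1" "Some z \<in> C"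
          by (auto simp: D_def)
        then have "x = opp (Some z)" using opp_circle[OF j] by simp
        then show "x \<in> holed" using z \<open>C \<subseteq> holed\<close> opp_holed by auto
      qed
      ultimately show ?thesis
        by (simp add: closedin_subset_topspace)
    qed
    then have "closedin holed_top (C \<union> (\<Union>j<2 * h. D j))"
      using C by (intro closedin_Un closedin_Union) auto
    moreover have "{x \<in> holed. glue x \<in> glue ` C} = C \<union> (\<Union>j<2 * h. D j)"
    proof (intro equalityI subsetI)
      fix x assume "x \<in> {x \<in> holed. glue x \<in> glue ` C}"
      then obtain y where y: "y \<in> C" "x = y \<or> x = opp y"
        by (auto simp: glue_eq_iff)
      then show "x \<in> C \<union> (\<Union>j<2 * h. D j)"
        by (cases y rule: opp_cases) (auto simp: D_def)
    next
      fix x assume x: "x \<in> C \<union> (\<Union>j<2 * h. D j)"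
      have "\<exists>y\<in>C. x = y \<or> x = opp y"
      proof (cases "x \<in> C")
        case False
        then obtain j z where z: "j < 2 * h" "x = Some (flip j z)" "cmod (z - c j) = 1" "Some z \<in> C"
          using x by (auto simp: D_def)
        then have "x = opp (Some z)" using opp_circle by simp
        then show ?thesis using z by blast
      qed blast
      then show "x \<in> {x \<in> holed. glue x \<in> glue ` C}"
        using \<open>C \<subseteq> holed\<close> opp_holed glue_opp by auto
    qed
    ultimately show ?thesis by simp
  qed
  moreover have "glue ` C \<subseteq> topspace glued" if "closedin holed_top C" for C
    using closedin_subset[OF that] by auto
  ultimately show ?thesis
    using quotient_glue unfolding quotient_map_closedin closed_map_def topspace_holed by blast
qed

lemma Hausdorff_glued: "Hausdorff_space glued"
proof -
  have "normal_space holed_top"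
    using compact_holed Hausdorff_holed by (simp add: compact_Hausdorff_or_regular_imp_normal_space)
  then show ?thesis
    using normal_Hausdorff_space_closed_continuous_map_image[OF _ Hausdorff_holed closed_glue continuous_glue]
    by simp
qed

end

section \<open>The point at infinity and connectedness\<close>

lemma continuous_map_inverse_Alexandroff:
  "continuous_map euclidean riemann_sphere (\<lambda>z. if z = 0 then None else Some (1 / z))"
  (is "continuous_map _ _ ?f")
proof -
  have "open {z. ?f z \<in> V}" if V: "openin riemann_sphere V" for V
  proof -
    have op: "open {z. z \<noteq> 0 \<and> 1 / z \<in> U}" if "open U" for U :: "complex set"
    proof -
      have "continuous_on (- {0::complex}) (\<lambda>z. 1 / z)"
        by (intro continuous_intros) auto
      then have "open ((- {0}) \<inter> (\<lambda>z. 1 / z) -` U)"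
        using that by (intro continuous_open_preimage) auto
      then show ?thesis by (simp add: vimage_def Collect_neg_eq[symmetric] Int_def)
    qed
    consider U where "open U" "V = Some ` U"
      | C where "compact C" "V = insert None (Some ` (- C))"
      using V by (auto simp: openin_Alexandroff_compactification Compl_eq_Diff_UNIV)
    then show ?thesis
    proof cases
      case 1
      then have "{z. ?f z \<in> V} = {z. z \<noteq> 0 \<and> 1 / z \<in> U}" by auto
      then show ?thesis using op[OF 1(1)] by simp
    next
      case 2
      obtain B where B: "B > 0" "\<And>z. z \<in> C \<Longrightarrow> cmod z \<le> B"
        using compact_imp_bounded[OF 2(1)] bounded_pos by metis
      \<comment> \<open>Continuity at 0: the compact set \<open>C\<close> missing from a
        neighbourhood of infinity is bounded, so small \<open>z\<close> have reciprocals beyond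
        it.\<close>
      have "1 / z \<notin> C" if "z \<noteq> 0" "cmod z < 1 / B" for z
        using B(2)[of "1 / z"] B(1) that by (auto simp: norm_divide field_simps)
      then have "{z. ?f z \<in> V} = ball 0 (1 / B) \<union> {z. z \<noteq> 0 \<and> 1 / z \<in> - C}"
        using 2 B(1) by auto
      moreover have "open (- C)" using 2 compact_imp_closed by blast
      ultimately show ?thesis
        using op[of "- C"] by (simp only: open_Un open_ball)
    qed
  qed
  then show ?thesis by (simp add: continuous_map_def)
qed

text \<open>The finite part is convex. Being unbounded, it meets the complement of every compact
  set, so \<open>None\<close> lies in its closure, and adding a closure point preserves
  connectedness.\<close>

lemma connectedin_vertical_ray:
  "connectedin riemann_sphere (insert None (Some ` {z. Re z = a \<and> b \<le> s * Im z}))"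
  if "s = 1 \<or> s = -1"
proof -
  let ?R = "{z. Re z = a \<and> b \<le> s * Im z}"
  have "?R = {z. a \<le> Re z} \<inter> {z. Re z \<le> a} \<inter> (if s = 1 then {z. b \<le> Im z} else {z. Im z \<le> - b})"
    using that by auto
  then have "convex ?R"
    by (simp add: convex_Int convex_halfspace_Re_ge convex_halfspace_Re_le convex_halfspace_Im_ge
        convex_halfspace_Im_le)
  then have "connectedin riemann_sphere (Some ` ?R)"
    by (intro connectedin_continuous_map_image[OF continuous_map_Some])
      (auto intro: convex_connected)
  moreover have "None \<in> riemann_sphere closure_of (Some ` ?R)"
  proof -
    have "\<exists>y\<in>Some ` ?R. y \<in> V" if V: "None \<in> V" "openin riemann_sphere V" for V
    proof -
      obtain C where C: "compact C" "V = insert None (Some ` (- C))"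
        using V by (auto simp: openin_Alexandroff_compactification Compl_eq_Diff_UNIV)
      obtain B where B: "\<And>z. z \<in> C \<Longrightarrow> cmod z \<le> B"
        using compact_imp_bounded[OF C(1)] bounded_pos by metis
      define z where "z = Complex a (s * (\<bar>b\<bar> + \<bar>B\<bar> + 1))"
      have "\<bar>Im z\<bar> \<le> cmod z" by (rule abs_Im_le_cmod)
      then have "z \<notin> C" using B[of z] \<open>s = 1 \<or> s = -1\<close> by (auto simp: z_def)
      moreover have "z \<in> ?R" using \<open>s = 1 \<or> s = -1\<close> by (auto simp: z_def)
      ultimately show ?thesis using C(2) by blast
    qed
    then show ?thesis by (auto simp: in_closure_of)
  qed
  ultimately show ?thesis
    using closure_of_subset[of "Some ` ?R" riemann_sphere]
      connectedin_intermediate_closure_of[of riemann_sphere "Some ` ?R" "insert None (Some ` ?R)"]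
    by auto
qed

context handle_discs
begin

text \<open>
  The centres are real, so the vertical ray from a point away from the real axis only recedes from
  the discs and joins the point to infinity.
\<close>

lemma connected_holed: "connected_space holed_top"
proof -
  have "\<exists>T. connectedin riemann_sphere T \<and> None \<in> T \<and> Some z \<in> T \<and> T \<subseteq> holed" if z: "Some z \<in> holed" for z
  proof -
    define s :: real where "s = (if 0 \<le> Im z then 1 else -1)"
    have s: "s = 1 \<or> s = -1" by (simp add: s_def)
    let ?R = "{w. Re w = Re z \<and> s * Im z \<le> s * Im w}"
    have "1 \<le> cmod (w - c j)" if w: "w \<in> ?R" and j: "j < 2 * h" for w j
    proof -
      have "(Im z)\<^sup>2 \<le> (Im w)\<^sup>2"
        using w by (auto simp: s_def abs_le_square_iff[symmetric] split: if_splits)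
      then have "cmod (z - c j) \<le> cmod (w - c j)"
        using w j centre_real by (auto simp: cmod_def)
      then show ?thesis using z j Some_in_holed by force
    qed
    then have "insert None (Some ` ?R) \<subseteq> holed"
      using Some_in_holed None_in_holed by blast
    then show ?thesis
      using connectedin_vertical_ray[OF s, of "Re z" "s * Im z"]
      by (intro exI[of _ "insert None (Some ` ?R)"]) auto
  qed
  then obtain T where T: "\<And>z. Some z \<in> holed \<Longrightarrow>
      connectedin riemann_sphere (T z) \<and> None \<in> T z \<and> Some z \<in> T z \<and> T z \<subseteq> holed"
    by metis
  \<comment> \<open>All members share the point \<open>None\<close>; the singleton puts
    \<open>None\<close> into the union without a look at whether the family of rays is
    empty.\<close>
  have "connectedin riemann_sphere (\<Union> (insert {None} (T ` {z. Some z \<in> holed})))"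
    by (rule connectedin_Union) (use T in auto)
  moreover have "\<Union> (insert {None} (T ` {z. Some z \<in> holed})) = holed"
  proof
    show "holed \<subseteq> \<Union> (insert {None} (T ` {z. Some z \<in> holed}))"
    proof
      fix x assume "x \<in> holed"
      then show "x \<in> \<Union> (insert {None} (T ` {z. Some z \<in> holed}))"
        using T by (cases x) auto
    qed
  qed (use T None_in_holed in auto)
  ultimately show ?thesis by (simp add: connectedin_def)
qed

text \<open>Closure under \<open>opp\<close> makes \<open>U \<inter> holed\<close> saturated, hence
  the full preimage of its image.\<close>

lemma openin_glued_image:
  assumes "openin riemann_sphere U" "A = glue ` (U \<inter> holed)" "\<And>x. x \<in> U \<inter> holed \<Longrightarrow> opp x \<in> U"
  shows "openin glued A"
proof -
  have "{x \<in> holed. glue x \<in> A} = holed \<inter> U"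
    using assms(2,3) by (auto simp: glue_eq_iff)
  moreover have "openin holed_top (holed \<inter> U)"
    using assms(1) by (rule openin_subtopology_Int2)
  ultimately show ?thesis
    using assms(2) unfolding openin_quotient_space topspace_holed by auto
qed

lemma continuous_map_glue_Some:
  assumes "continuous_on K g" "\<And>z. z \<in> K \<Longrightarrow> Some (g z) \<in> holed"
  shows "continuous_map (top_of_set K) glued (\<lambda>z. glue (Some (g z)))"
proof -
  have "continuous_map (top_of_set K) riemann_sphere (Some \<circ> g)"
    using assms(1) by (intro continuous_map_compose[OF _ continuous_map_Some]) auto
  then have "continuous_map (top_of_set K) holed_top (Some \<circ> g)"
    using assms(2) by (auto simp: continuous_map_in_subtopology)
  then show ?thesis
    using continuous_map_compose[OF _ continuous_glue] by (fastforce simp: o_def)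
qed

section \<open>Charts of the glued space\<close>

definition has_chart :: "complex option \<Rightarrow> bool" where
  "has_chart x \<longleftrightarrow> (\<exists>U (W :: complex set). openin glued U \<and> x \<in> U \<and> open W \<and>
        subtopology glued U homeomorphic_space top_of_set W)"

text \<open>The slightly larger compact \<open>K\<close> makes \<open>local_chart\<close>
  applicable; continuity and injectivity are checked on \<open>K\<close>, openness only for the
  image of \<open>W\<close>.\<close>

lemma has_chartI:
  fixes W :: "complex set"
  assumes "compact K" "open W" "W \<subseteq> K" "continuous_map (top_of_set K) glued f" "inj_on f K"
    "openin glued (f ` W)" "x \<in> f ` W"
  shows "has_chart x"
  unfolding has_chart_def
  by (intro exI[of _ "f ` W"] exI[of _ W] conjI local_chart[OF Hausdorff_glued assms(1,3,4,5)] assms)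

lemma chart_infinity: "has_chart (glue None)"
proof -
  \<comment> \<open>The 0 keeps the maximum defined when there are no discs. The summand 2 keeps all
    points of modulus at least \<open>R\<close> off the circles, so that \<open>opp\<close> fixes
    them.\<close>
  define R where "R = Max ((\<lambda>j. cmod (c j)) ` {..<2 * h} \<union> {0}) + 2"
  have "cmod (c j) \<le> Max ((\<lambda>j. cmod (c j)) ` {..<2 * h} \<union> {0})" if "j < 2 * h" for j
    using that by (intro Max_ge) auto
  then have R: "cmod (c j) + 2 \<le> R" if "j < 2 * h" for j
    using that by (force simp: R_def)
  have "0 \<le> Max ((\<lambda>j. cmod (c j)) ` {..<2 * h} \<union> {0})" by (intro Max_ge) auto
  then have "0 < R" unfolding R_def by linarith
  have far: "2 \<le> cmod (z - c j)" if "R \<le> cmod z" "j < 2 * h" for z j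
    using R[OF that(2)] that(1) norm_triangle_ineq2[of z "c j"] by linarith
  then have opp_far: "opp (Some z) = Some z" if "R \<le> cmod z" for z
    using that by (intro opp_off_circle) fastforce
  define g where "g = (\<lambda>z::complex. if z = 0 then None else Some (1 / z))"
  have inv: "R \<le> cmod (1 / z)" if "z \<noteq> 0" "cmod z \<le> 1 / R" for z
    using that \<open>0 < R\<close> by (auto simp: norm_divide field_simps)
  have g_dom: "g z \<in> holed" and g_opp: "opp (g z) = g z" if "z \<in> cball 0 (1 / R)" for z
  proof -
    show "g z \<in> holed"
    proof (cases "z = 0")
      case False
      then have "R \<le> cmod (1 / z)" using inv that by auto
      then show ?thesis using False far by (fastforce simp: g_def Some_in_holed)
    qed (simp add: g_def None_in_holed)
    show "opp (g z) = g z"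
      using inv[of z] opp_far that by (auto simp: g_def)
  qed
  show ?thesis
  proof (rule has_chartI[of "cball 0 (1 / R)" "ball 0 (1 / R)" "glue \<circ> g"])
    have "continuous_map (top_of_set (cball 0 (1 / R))) holed_top g"
      using continuous_map_from_subtopology[OF continuous_map_inverse_Alexandroff] g_dom
      by (auto simp: continuous_map_in_subtopology g_def)
    then show "continuous_map (top_of_set (cball 0 (1 / R))) glued (glue \<circ> g)"
      using continuous_glue continuous_map_compose by blast
    have "inj g" by (auto simp: g_def inj_def split: if_splits)
    then show "inj_on (glue \<circ> g) (cball 0 (1 / R))"
      using g_opp by (auto simp: inj_on_def glue_eq_iff)
    have U: "insert None (Some ` {z. R < cmod z}) = g ` ball 0 (1 / R)"
    proof (intro equalityI subsetI)
      fix x assume "x \<in> insert None (Some ` {z. R < cmod z})"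
      then consider "x = None" | z where "x = Some z" "R < cmod z" by auto
      then show "x \<in> g ` ball 0 (1 / R)"
      proof cases
        case 1 then show ?thesis using \<open>0 < R\<close> by (intro image_eqI[of _ _ 0]) (auto simp: g_def)
      next
        case 2
        then have "1 / cmod z < 1 / R"
          using \<open>0 < R\<close> by (intro divide_strict_left_mono mult_pos_pos) linarith+
        then show ?thesis using 2 \<open>0 < R\<close>
          by (intro image_eqI[of _ _ "1 / z"]) (auto simp: g_def norm_divide)
      qed
    next
      fix x assume "x \<in> g ` ball 0 (1 / R)"
      then show "x \<in> insert None (Some ` {z. R < cmod z})"
        using \<open>0 < R\<close> by (auto simp: g_def norm_divide field_simps)
    qed
    show "openin glued ((glue \<circ> g) ` ball 0 (1 / R))"
    proof (rule openin_glued_image)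
      have "{z. R < cmod z} = topspace euclidean - cball 0 R" by auto
      then show "openin riemann_sphere (insert None (Some ` {z. R < cmod z}))"
        unfolding openin_Alexandroff_compactification using compact_cball[of "0::complex" R]
        by (metis closed_cball closed_closedin compactin_euclidean_iff)
      show "(glue \<circ> g) ` ball 0 (1 / R) = glue ` (insert None (Some ` {z. R < cmod z}) \<inter> holed)"
        unfolding U using g_dom by (fastforce simp: image_comp)
      show "opp x \<in> insert None (Some ` {z. R < cmod z})"
        if "x \<in> insert None (Some ` {z. R < cmod z}) \<inter> holed" for x
        using that opp_far by auto
    qed
    show "glue None \<in> (glue \<circ> g) ` ball 0 (1 / R)"
      using \<open>0 < R\<close> by (intro image_eqI[of _ _ 0]) (auto simp: g_def)
  qed auto
qed

text \<open>Away from the closed unit discs \<open>opp\<close> is the identity, so a small disc of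
  the plane serves as its own chart.\<close>

lemma chart_regular:
  assumes "\<And>j. j < 2 * h \<Longrightarrow> 1 < cmod (z - c j)"
  shows "has_chart (glue (Some z))"
proof -
  define Q where "Q = (\<Inter>j<2 * h. - cball (c j) 1)"
  have "open Q" unfolding Q_def by (intro open_INT) auto
  have Q: "w \<in> Q \<longleftrightarrow> (\<forall>j<2 * h. 1 < cmod (w - c j))" for w
    by (auto simp: Q_def dist_norm norm_minus_commute not_le)
  have holed: "Some w \<in> holed" and opp: "opp (Some w) = Some w" if "w \<in> Q" for w
    using that by (force simp: Q Some_in_holed intro!: opp_off_circle)+
  obtain e where e: "0 < e" "cball z e \<subseteq> Q"
    using \<open>open Q\<close> assms Q open_contains_cball by metis
  then have Qb: "w \<in> Q" if "dist z w \<le> e" for w using that by auto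
  show ?thesis
  proof (rule has_chartI[of "cball z e" "ball z e" "\<lambda>w. glue (Some w)"])
    show "continuous_map (top_of_set (cball z e)) glued (\<lambda>w. glue (Some w))"
      using continuous_map_glue_Some[of "cball z e" "\<lambda>w. w"] holed Qb by auto
    show "inj_on (\<lambda>w. glue (Some w)) (cball z e)"
      using opp Qb by (auto simp: inj_on_def glue_eq_iff)
    show "openin glued ((\<lambda>w. glue (Some w)) ` ball z e)"
    proof (rule openin_glued_image)
      show "openin riemann_sphere (Some ` ball z e)"
        by (subst openin_Alexandroff_compactification_image_Some) auto
      show "(\<lambda>w. glue (Some w)) ` ball z e = glue ` (Some ` ball z e \<inter> holed)"
        using holed Qb by (force simp: image_def)
      show "opp x \<in> Some ` ball z e" if "x \<in> Some ` ball z e \<inter> holed" for x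
        using that opp Qb by auto
    qed
  qed (use e in auto)
qed

text \<open>
  The collars of the two glued circles form an annulus: the coordinate is \<open>z - c j\<close> on
  the first collar and \<open>- 1 / (z - c (mate j))\<close> on the second, and on the unit circle
  \<open>1 / w = cnj w\<close> makes the two agree under \<open>flip j\<close>.
\<close>

lemma chart_circle:
  assumes j: "j < 2 * h" and z: "cmod (z - c j) = 1"
  shows "has_chart (glue (Some z))"
proof -
  define m where "m = mate j"
  have m: "m < 2 * h" "m \<noteq> j" "mate m = j"
    using j mate_less mate_neq by (auto simp: m_def)
  define g where "g w = (if 1 \<le> cmod w then c j + w else c m - 1 / w)" for w
  \<comment> \<open>Inversion turns moduli from 1/2 to 1 into moduli from 1 to 2, so
    \<open>g\<close> covers one collar from each half of this annulus.\<close>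
  let ?K = "cball 0 2 - ball 0 (1 / 2) :: complex set"
  let ?W = "ball 0 2 - cball 0 (1 / 2) :: complex set"
  let ?A = "\<lambda>j z. 1 \<le> cmod (z - c j) \<and> cmod (z - c j) \<le> 2"
  have A_dom: "Some w \<in> holed" if i: "i < 2 * h" and w: "?A i w" for i w
  proof -
    have "1 \<le> cmod (w - c k)" if k: "k < 2 * h" for k
      using near_unique[OF i k, of w] w by (cases "k = i") (simp, linarith)
    then show ?thesis by (simp add: Some_in_holed)
  qed
  have opp_A: "opp (Some w) = (if cmod (w - c i) = 1 then Some (flip i w) else Some w)"
    if i: "i < 2 * h" and w: "?A i w" for i w
  proof (cases "cmod (w - c i) = 1")
    case False
    have "cmod (w - c k) \<noteq> 1" if k: "k < 2 * h" for k
      using near_unique[OF i k, of w] w False by (cases "k = i") auto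
    then show ?thesis using False opp_off_circle by simp
  qed (use opp_circle i in auto)
  have inv: "1 \<le> cmod (1 / w)" "cmod (1 / w) \<le> 2" if "1 / 2 \<le> cmod w" "cmod w \<le> 1" for w
  proof -
    have "0 < cmod w" using that by linarith
    then show "1 \<le> cmod (1 / w)" "cmod (1 / w) \<le> 2"
      using that by (simp_all add: norm_divide field_simps)
  qed
  have inv1: "1 / w = cnj w" if "cmod w = 1" for w
    using that complex_div_cnj[of 1 w] by simp
  have g1: "?A j (c j + w)" if "1 \<le> cmod w" "cmod w \<le> 2" for w
    using that by simp
  have g2: "?A m (c m - 1 / w)" if "1 / 2 \<le> cmod w" "cmod w \<le> 1" for w
    using inv[OF that] by simp
  have disj: False if "?A j w" "?A m w" for w
    using near_unique[OF j m(1), of w] that m(2) by auto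
  show ?thesis
  proof (rule has_chartI[of ?K ?W "\<lambda>w. glue (Some (g w))"])
    show "compact ?K" by (intro compact_diff) auto
    show "open ?W" by (intro open_Diff) auto
    show "?W \<subseteq> ?K" by auto
    have "continuous_map (top_of_set ?K) glued
       (\<lambda>w. if 1 \<le> cmod w then glue (Some (c j + w)) else glue (Some (c m - 1 / w)))"
    proof (rule continuous_map_cases_le)
      show "continuous_map (top_of_set ?K) euclideanreal (\<lambda>w. 1)"
        "continuous_map (top_of_set ?K) euclideanreal cmod"
        by (auto intro!: continuous_intros)
      have "continuous_map (top_of_set (?K \<inter> {w. 1 \<le> cmod w})) glued (\<lambda>w. glue (Some (c j + w)))"
        by (rule continuous_map_glue_Some) (use A_dom[OF j g1] in \<open>auto intro!: continuous_intros\<close>)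
      then show "continuous_map (subtopology (top_of_set ?K) {w \<in> topspace (top_of_set ?K). 1 \<le> cmod w}) glued
          (\<lambda>w. glue (Some (c j + w)))"
        by (simp add: subtopology_subtopology Int_def conj_ac)
      have "continuous_map (top_of_set (?K \<inter> {w. cmod w \<le> 1})) glued (\<lambda>w. glue (Some (c m - 1 / w)))"
        by (rule continuous_map_glue_Some) (use A_dom[OF m(1) g2] in \<open>auto intro!: continuous_intros\<close>)
      then show "continuous_map (subtopology (top_of_set ?K) {w \<in> topspace (top_of_set ?K). cmod w \<le> 1}) glued
          (\<lambda>w. glue (Some (c m - 1 / w)))"
        by (simp add: subtopology_subtopology Int_def conj_ac)
      \<comment> \<open>On the seam the two points of the plane differ, but \<open>opp\<close>
        exchanges them; the branches can be pasted only after \<open>glue\<close>.\<close>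
      show "glue (Some (c j + w)) = glue (Some (c m - 1 / w))" if "1 = cmod w" for w
        using that opp_circle[OF j, of "c j + w"] inv1[of w]
        by (simp add: glue_eq_iff flip_def m_def) (metis opp_opp)
    qed
    then show "continuous_map (top_of_set ?K) glued (\<lambda>w. glue (Some (g w)))"
      by (rule continuous_map_eq) (simp add: g_def)
    show "inj_on (\<lambda>w. glue (Some (g w))) ?K"
    proof (rule inj_onI)
      fix v w assume v: "v \<in> ?K" and w: "w \<in> ?K" and eq: "glue (Some (g v)) = glue (Some (g w))"
      \<comment> \<open>The seam is assigned to the collar of \<open>j\<close> alone, and
        \<open>g\<close> never meets the circle around \<open>c m\<close>. So \<open>opp\<close>
        either fixes a value of \<open>g\<close> or moves it out of the range of \<open>g\<close> on
        \<open>?K\<close>, and \<open>glue\<close> identifies no two values.\<close>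
      have gA: "if 1 \<le> cmod u then ?A j (g u) else ?A m (g u) \<and> cmod (g u - c m) \<noteq> 1" if "u \<in> ?K" for u
      proof (cases "1 \<le> cmod u")
        case True then show ?thesis using that by (simp add: g_def)
      next
        case False
        then have "u \<noteq> 0" using that by auto
        with False have "1 < cmod (1 / u)" by (simp add: norm_divide field_simps)
        then show ?thesis using that False inv[of u] by (simp add: g_def)
      qed
      have opp: "opp (Some (g u)) = Some (g u) \<or> (\<exists>y. opp (Some (g u)) = Some y \<and> ?A m y \<and> cmod (y - c m) = 1)"
        if "u \<in> ?K" for u
        using gA[OF that] opp_A[OF j, of "g u"] opp_A[OF m(1), of "g u"] flip_circle[of "g u" j]
        by (auto simp: m_def split: if_splits)
      have "g v = g w"
        using eq opp[OF w] gA[OF v] disj[of "g v"] by (auto simp: glue_eq_iff split: if_splits)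
      then show "v = w"
        using gA[OF v] gA[OF w] disj[of "g v"] by (auto simp: g_def split: if_splits)
    qed
    let ?U = "Some ` (ball (c j) 2 \<union> ball (c m) 2)"
    show "openin glued ((\<lambda>w. glue (Some (g w))) ` ?W)"
    proof (rule openin_glued_image)
      show "openin riemann_sphere ?U"
        by (subst openin_Alexandroff_compactification_image_Some) auto
      show "opp x \<in> ?U" if xU: "x \<in> ?U \<inter> holed" for x
      proof -
        obtain y where "x = Some y" "cmod (y - c j) < 2 \<or> cmod (y - c m) < 2"
          using xU by (auto simp: dist_norm norm_minus_commute)
        then obtain i where y: "x = Some y" "i = j \<or> i = m" "cmod (y - c i) < 2"
          by blast
        have i: "i < 2 * h" using y(2) j m by auto
        then have "?A i y" using that y Some_in_holed by force
        then have "opp x = x \<or> (opp x = Some (flip i y) \<and> cmod (flip i y - c (mate i)) = 1)"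
          using opp_A[OF i] flip_circle y(1) by auto
        moreover have "mate i = j \<or> mate i = m" using y(2) m m_def by auto
        ultimately show ?thesis using that
          by (fastforce simp: dist_norm norm_minus_commute)
      qed
      show "(\<lambda>w. glue (Some (g w))) ` ?W = glue ` (?U \<inter> holed)"
      proof (intro equalityI subsetI)
        fix x assume "x \<in> (\<lambda>w. glue (Some (g w))) ` ?W"
        then obtain w where w: "w \<in> ?W" "x = glue (Some (g w))" by blast
        have "Some (g w) \<in> ?U \<inter> holed"
        proof (cases "1 \<le> cmod w")
          case True
          then show ?thesis using w A_dom[OF j g1[of w]] by (auto simp: g_def dist_norm)
        next
          case False
          have "1 / cmod w < 1 / (1 / 2)"
            using w(1) by (intro divide_strict_left_mono) auto
          then have "cmod (1 / w) < 2" by (simp add: norm_divide)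
          then show ?thesis using w(1) False A_dom[OF m(1) g2[of w]]
            by (auto simp: g_def dist_norm)
        qed
        then show "x \<in> glue ` (?U \<inter> holed)" using w by blast
      next
        fix x assume "x \<in> glue ` (?U \<inter> holed)"
        then obtain y where y: "x = glue (Some y)" "Some y \<in> holed" "y \<in> ball (c j) 2 \<union> ball (c m) 2"
          by auto
        show "x \<in> (\<lambda>w. glue (Some (g w))) ` ?W"
        proof (cases "y \<in> ball (c j) 2")
          case True
          then have "1 \<le> cmod (y - c j)" "cmod (y - c j) < 2"
            using y(2) j by (auto simp: Some_in_holed dist_norm norm_minus_commute)
          then show ?thesis using y(1) by (intro image_eqI[of _ _ "y - c j"]) (auto simp: g_def)
        next
          case False
          then have n: "1 \<le> cmod (y - c m)" "cmod (y - c m) < 2"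
            using y(2,3) m by (auto simp: Some_in_holed dist_norm norm_minus_commute)
          \<comment> \<open>Points on the circle around \<open>c m\<close> are not values of
            \<open>g\<close>; they are reached through their partners on the circle around
            \<open>c j\<close>.\<close>
          show ?thesis
          proof (cases "cmod (y - c m) = 1")
            case True
            then have "Some (flip m y) = opp (Some y)" "cmod (flip m y - c j) = 1"
              using opp_circle[OF m(1)] flip_circle[of y m] m(3) by auto
            then show ?thesis using y(1)
              by (intro image_eqI[of _ _ "flip m y - c j"]) (auto simp: g_def glue_opp)
          next
            case False
            define w where "w = - 1 / (y - c m)"
            have "y \<noteq> c m" using n by auto
            have "cmod w = 1 / cmod (y - c m)" by (simp add: w_def norm_divide)
            moreover have "1 / 2 < 1 / cmod (y - c m)" "1 / cmod (y - c m) < 1 / 1"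
              using n False by (intro divide_strict_left_mono mult_pos_pos; linarith)+
            ultimately have "1 / 2 < cmod w" "cmod w < 1" by simp_all
            moreover have "c m - 1 / w = y" using \<open>y \<noteq> c m\<close> by (simp add: w_def)
            ultimately show ?thesis using y(1) by (intro image_eqI[of _ _ w]) (auto simp: g_def)
          qed
        qed
      qed
    qed
    show "glue (Some z) \<in> (\<lambda>w. glue (Some (g w))) ` ?W"
      using z by (intro image_eqI[of _ _ "z - c j"]) (auto simp: g_def)
  qed
qed

lemma surface_glued: "surface glued"
proof -
  have "compact_space glued"
    using compact_holed quotient_glue quotient_imp_surjective_map[OF quotient_glue] image_compactin[OF _ continuous_glue]
    by (metis compact_space_def)
  moreover have "connected_space glued"
    using connected_holed quotient_glue connected_space_quotient_map_image by blast
  moreover have "has_chart x" if x: "x \<in> topspace glued" for x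
  proof -
    obtain y where y: "x = glue y" "y \<in> holed" using x by auto
    show ?thesis
    proof (cases y)
      case None
      then show ?thesis using y chart_infinity by simp
    next
      case (Some z)
      then show ?thesis
        using y chart_regular[of z] chart_circle[of _ z] Some_in_holed[of z]
        by (metis less_eq_real_def)
    qed
  qed
  ultimately show ?thesis
    using Hausdorff_glued None_in_holed by (auto simp: surface_def has_chart_def)
qed

lemma sphere_with_handles_glued: "sphere_with_handles h glued"
  unfolding sphere_with_handles_def
proof (intro exI conjI ballI)
  show "disjoint_discs (2 * h) c (\<lambda>_. 1)"
  proof -
    have "cball (c i) 1 \<inter> cball (c j) 1 = {}" if "i < 2 * h" "j < 2 * h" "i \<noteq> j" for i j
    proof -
      have False if "cmod (z - c i) \<le> 1" "cmod (z - c j) \<le> 1" for z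
        using near_unique[of i j z] that \<open>i < 2 * h\<close> \<open>j < 2 * h\<close> \<open>i \<noteq> j\<close> by simp
      then show ?thesis by (auto simp: dist_norm norm_minus_commute)
    qed
    then show ?thesis by (simp add: disjoint_discs_def)
  qed
  show "quotient_map holed_top glued glue" by (rule quotient_glue)
  have pair: "y = opp x" if "handle_pair h c (\<lambda>_. 1) x y" for x y
    using that opp_circle[of "2 * _" "c (2 * _) + _"]
    by (auto simp: handle_pair_def flip_def)
  show "(glue x = glue y) = (x = y \<or> handle_pair h c (\<lambda>_. 1) x y \<or> handle_pair h c (\<lambda>_. 1) y x)"
    if "x \<in> holed" "y \<in> holed" for x y
  proof
    assume "x = y \<or> handle_pair h c (\<lambda>_. 1) x y \<or> handle_pair h c (\<lambda>_. 1) y x"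
    then show "glue x = glue y" using pair glue_opp by metis
  next
    assume "glue x = glue y"
    then have "x = y \<or> y = opp x" using opp_opp by (auto simp: glue_eq_iff)
    then show "x = y \<or> handle_pair h c (\<lambda>_. 1) x y \<or> handle_pair h c (\<lambda>_. 1) y x"
    proof (cases x rule: opp_cases)
      case (3 z j)
      show ?thesis
      \<comment> \<open>\<open>handle_pair\<close> is directed from the disc \<open>2 * i\<close> to
        its successor, so for odd \<open>j\<close> the point \<open>opp x\<close> has to come
        first.\<close>
      proof (cases "even j")
        case True
        then obtain i where i: "j = 2 * i" by auto
        have "handle_pair h c (\<lambda>_. 1) x (opp x)"
          unfolding handle_pair_def using 3 i
          by (intro exI[of _ i] exI[of _ "z - c j"]) (auto simp: flip_def)
        then show ?thesis using \<open>x = y \<or> y = opp x\<close> by auto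
      next
        case False
        then obtain i where i: "j = Suc (2 * i)" by (auto elim: oddE)
        have "handle_pair h c (\<lambda>_. 1) (opp x) x"
          unfolding handle_pair_def using 3 i
          by (intro exI[of _ i] exI[of _ "- cnj (z - c j)"])
            (auto simp: flip_def simp del: complex_cnj_diff)
        then show ?thesis using \<open>x = y \<or> y = opp x\<close> by auto
      qed
    qed auto
  qed
qed

end

section \<open>One handle for each edge\<close>

text \<open>If \<open>u < v\<close>, the left side is below \<open>(u + 1) * N\<close> and the right
  side at least \<open>v * N\<close>. The remainders are real because they will also be the digits
  \<open>t * j\<close> of points along a segment.\<close>

lemma base_digit_unique:
  fixes u v N :: nat and p q :: real
  assumes "real (u * N) + p = real (v * N) + q" "0 \<le> p" "p < N" "0 \<le> q" "q < N"
  shows "u = v \<and> p = q"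
proof -
  have *: "\<not> u < v" if "real (u * N) + p = real (v * N) + q" "p < N" "0 \<le> q" for u v p q
  proof
    assume "u < v"
    then have "Suc u * N \<le> v * N" by (intro mult_right_mono) auto
    then have "real (Suc u * N) \<le> real (v * N)" by (rule of_nat_mono)
    then show False using that by (simp add: algebra_simps)
  qed
  have "u = v" using *[of u p v q] *[of v q u p] assms by linarith
  then show ?thesis using assms by simp
qed

text \<open>
  Each edge gets a handle whose two discs lie above its two ends. The arc of the edge runs straight up
  to the lowest point of one disc, which is glued to the lowest point of the other disc, and
  then straight down. The discs above one vertex occupy a block of abscissae of length less than
  \<open>5 * N\<close>, so that the stars of straight segments at different vertices are disjoint.
\<close>

theorem embeddable_in_genus_twice_card:
  fixes V :: "nat set"
  assumes "simple_graph V E"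
  shows "embeddable_in_genus V E (2 * card E)"
proof -
  have "finite V" and E: "E \<subseteq> {{u, v} | u v. u \<in> V \<and> v \<in> V \<and> u \<noteq> v}"
    using assms by (auto simp: simple_graph_def)
  then have "finite E" by (intro finite_subset[of E "Pow V"]) auto
  define h where "h = card E"
  \<comment> \<open>Disc numbers \<open>j < 2 * h\<close> become digits in base \<open>N\<close>;
    the \<open>+ 1\<close> keeps \<open>N\<close> positive, and the vertices apart, even without
    edges.\<close>
  define N where "N = 2 * h + 1"
  obtain en where en: "bij_betw en {0..<h} E"
    using ex_bij_betw_nat_finite[OF \<open>finite E\<close>] by (auto simp: h_def)
  have "\<exists>u v. u \<noteq> v \<and> en i = {u, v}" if "i < h" for i
  proof -
    have "en i \<in> E" using bij_betwE[OF en] that by auto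
    then show ?thesis using E by blast
  qed
  then obtain a b where ab: "\<And>i. i < h \<Longrightarrow> a i \<noteq> b i \<and> en i = {a i, b i}"
    by metis
  \<comment> \<open>Disc \<open>j\<close> lies above the end \<open>vt j\<close> of the edge
    \<open>j div 2\<close>. The integers \<open>vt j * N + j\<close> are distinct, so the factor 5
    in \<open>c\<close> yields the required distance.\<close>
  define vt where "vt j = (if even j then a (j div 2) else b (j div 2))" for j
  define c where "c j = complex_of_real (5 * real (vt j * N + j))" for j
  interpret handle_discs h c
  proof
    show "Im (c j) = 0" for j by (simp add: c_def)
    show "5 \<le> dist (c i) (c j)" if ij: "i < 2 * h" "j < 2 * h" "i \<noteq> j" for i j
    proof -
      have "vt i * N + i \<noteq> vt j * N + j"
      proof
        assume "vt i * N + i = vt j * N + j"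
        then have "real (vt i * N) + real i = real (vt j * N) + real j"
          by (metis of_nat_add)
        then show False using base_digit_unique[of "vt i" N "real i" "vt j" "real j"] ij
          by (simp add: N_def)
      qed
      then have "1 \<le> \<bar>real (vt i * N + i) - real (vt j * N + j)\<bar>" by linarith
      moreover have "1 \<le> \<bar>x - y\<bar> \<Longrightarrow> 5 \<le> \<bar>5 * x - 5 * y\<bar>" for x y :: real by linarith
      ultimately show ?thesis unfolding c_def dist_of_real dist_real_def by blast
    qed
  qed
  \<comment> \<open>The height \<open>t - 2\<close> reveals \<open>t\<close>; the abscissa divided
    by 5 is then a base \<open>N\<close> expansion with digit \<open>t * j\<close>. Hence segments
    of different discs can meet only at \<open>t = 0\<close>, in a common vertex.\<close>
  define seg where "seg j t = Complex (5 * (real (vt j * N) + t * real j)) (t - 2)" for j t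
  define apex where "apex v = Complex (5 * real (v * N)) (- 2)" for v
  define P where "P j t = glue (Some (seg j t))" for j t
  define pt where "pt v = glue (Some (apex v))" for v
  \<comment> \<open>Depth below the real axis bounds the distance to all centres at once. The
    drawing stays at heights at most -1, so only its points at height -1 can lie on a
    circle.\<close>
  have Im_below: "\<bar>Im z\<bar> \<le> cmod (z - c j)" for z j
    using abs_Im_le_cmod[of "z - c j"] by (simp add: c_def)
  have seg_dom: "Some (seg j t) \<in> holed" if "t \<le> 1" for j t
    unfolding Some_in_holed
  proof (intro allI impI)
    fix k
    have "1 \<le> \<bar>Im (seg j t)\<bar>" using that by (simp add: seg_def)
    then show "1 \<le> cmod (seg j t - c k)" using Im_below[of "seg j t" k] by linarith
  qed
  have seg_opp: "opp (Some (seg j t)) = Some (seg j t)" if "t < 1" for j t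
  proof (rule opp_off_circle)
    fix k
    have "1 < \<bar>Im (seg j t)\<bar>" using that by (simp add: seg_def)
    then show "cmod (seg j t - c k) \<noteq> 1" using Im_below[of "seg j t" k] by linarith
  qed
  have seg1: "seg j 1 = c j - \<i>" for j
    by (simp add: seg_def c_def complex_eq_iff algebra_simps)
  have seg1_opp: "opp (Some (seg j 1)) = Some (seg (mate j) 1)" if "j < 2 * h" for j
    using opp_circle[OF that, of "seg j 1"] by (simp add: seg1 flip_def)
  have apex_eq: "apex v = apex w \<longleftrightarrow> v = w" for v w
  proof -
    have "0 < N" by (simp add: N_def)
    then show ?thesis by (simp add: apex_def)
  qed
  have seg0: "seg j 0 = apex (vt j)" for j
    by (simp add: seg_def apex_def)
  have apex_dom: "Some (apex v) \<in> holed" and apex_opp: "opp (Some (apex v)) = Some (apex v)" for v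
  proof -
    have far: "1 < cmod (apex v - c k)" for k
      using Im_below[of "apex v" k] by (simp add: apex_def)
    then show "Some (apex v) \<in> holed"
      by (simp add: Some_in_holed less_imp_le)
    show "opp (Some (apex v)) = Some (apex v)"
      using far less_irrefl by (metis opp_off_circle)
  qed
  have seg_eq: "t = s \<and> (j = k \<or> t = 0 \<and> vt j = vt k)"
    if "seg j t = seg k s" "j < 2 * h" "k < 2 * h" "0 \<le> t" "t \<le> 1" for j k t s
  proof -
    have "t = s" using that(1) by (simp add: seg_def)
    moreover have small: "0 \<le> t * real i \<and> t * real i < real N" if "i < 2 * h" for i
    proof -
      have "t * real i \<le> 1 * real i" using \<open>t \<le> 1\<close> by (intro mult_right_mono) auto
      then show ?thesis using \<open>0 \<le> t\<close> that by (simp add: N_def)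
    qed
    moreover have "real (vt j * N) + t * real j = real (vt k * N) + t * real k"
      using that(1) \<open>t = s\<close> by (simp add: seg_def)
    ultimately show ?thesis
      using base_digit_unique[of "vt j" N "t * real j" "vt k" "t * real k"] small that(2,3) by auto
  qed
  have P_eq: "t = s \<and> (j = k \<or> t = 0 \<and> vt j = vt k \<or> t = 1 \<and> j = mate k)"
    if eq: "P j t = P k s" and jk: "j < 2 * h" "k < 2 * h" and ts: "0 \<le> t" "t \<le> 1" "0 \<le> s" "s \<le> 1" for j k t s
  proof (cases "s < 1")
    case True
    then have "seg j t = seg k s" using eq seg_opp by (simp add: P_def glue_eq_iff)
    then show ?thesis using seg_eq jk ts by blast
  next
    case False
    then have "s = 1" using ts by simp
    then have "seg j t = seg k 1 \<or> seg j t = seg (mate k) 1"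
      using eq seg1_opp[OF jk(2)] by (simp add: P_def glue_eq_iff)
    then show ?thesis
      using seg_eq[of j t k 1] seg_eq[of j t "mate k" 1] jk mate_less ts \<open>s = 1\<close> by auto
  qed
  have P_joint: "P (2 * i) 1 = P (Suc (2 * i)) 1" if "i < h" for i
    using seg1_opp[of "2 * i"] that glue_opp[of "Some (seg (2 * i) 1)"] by (simp add: P_def)
  have P_pt: "t = 0" if "P j t = pt v" for j t v
    using that apex_opp by (simp add: P_def pt_def glue_eq_iff) (simp add: seg_def apex_def)
  have P_continuous: "continuous_map (top_of_set K) glued (\<lambda>t. P j (f t))"
    if "continuous_on K f" "\<And>t. t \<in> K \<Longrightarrow> f t \<le> 1" for j K and f :: "real \<Rightarrow> real"
    unfolding P_def
  proof (rule continuous_map_glue_Some)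
    show "continuous_on K (\<lambda>t. seg j (f t))"
      unfolding seg_def Complex_eq using that(1) by (intro continuous_intros)
  qed (use that seg_dom in auto)
  define ix where "ix f = inv_into {0..<h} en f" for f
  have ix: "ix f < h" "f = {a (ix f), b (ix f)}" "a (ix f) \<noteq> b (ix f)" if "f \<in> E" for f
  proof -
    have "ix f \<in> {0..<h}" "en (ix f) = f"
      using en that by (auto simp: ix_def bij_betw_def inv_into_into f_inv_into_f)
    then show "ix f < h" "f = {a (ix f), b (ix f)}" "a (ix f) \<noteq> b (ix f)"
      using ab by auto
  qed
  \<comment> \<open>A dart is half of an edge. Its height parameter \<open>u\<close> rises to 1 at
    the midpoint, where the curve passes through the handle, and falls back to 0.\<close>
  define dart where "dart f t = (if t \<le> 1 / 2 then 2 * ix f else Suc (2 * ix f))" for f and t :: real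
  define u :: "real \<Rightarrow> real" where "u t = (if t \<le> 1 / 2 then 2 * t else 2 - 2 * t)" for t
  define \<gamma> where "\<gamma> f t = P (dart f t) (u t)" for f t
  have dart_less: "dart f t < 2 * h" if "f \<in> E" for f t
    using ix(1)[OF that] by (auto simp: dart_def)
  have dart_div: "dart f t div 2 = ix f" and mate_dart_div: "mate (dart f t) div 2 = ix f" for f t
    by (auto simp: dart_def)
  have u_range: "0 \<le> u t" "u t \<le> 1" if "0 \<le> t" "t \<le> 1" for t
    using that by (auto simp: u_def)
  have u_pos: "0 < u t" if "0 < t" "t < 1" for t
    using that by (auto simp: u_def)
  have "graph_embedding V E glued pt \<gamma>"
    unfolding graph_embedding_def
  proof (intro conjI ballI impI)
    show "pt ` V \<subseteq> topspace glued" using apex_dom by (auto simp: pt_def)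
    show "inj_on pt V" by (auto simp: inj_on_def pt_def glue_eq_iff apex_opp apex_eq)
  next
    fix f assume f: "f \<in> E"
    have "continuous_map (top_of_set {0..1}) glued
        (\<lambda>t. if t \<le> 1 / 2 then P (2 * ix f) (2 * t) else P (Suc (2 * ix f)) (2 - 2 * t))"
    proof (rule continuous_map_cases_le)
      have "continuous_map (top_of_set ({0..1} \<inter> {t. t \<le> 1 / 2})) glued (\<lambda>t. P (2 * ix f) (2 * t))"
        by (rule P_continuous) (auto intro!: continuous_intros)
      then show "continuous_map (subtopology (top_of_set {0..1}) {t \<in> topspace (top_of_set {0..1}). t \<le> 1 / 2}) glued
          (\<lambda>t. P (2 * ix f) (2 * t))"
        by (simp add: subtopology_subtopology Int_def conj_ac)
      have "continuous_map (top_of_set ({0..1} \<inter> {t. 1 / 2 \<le> t})) glued (\<lambda>t. P (Suc (2 * ix f)) (2 - 2 * t))"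
        by (rule P_continuous) (auto intro!: continuous_intros)
      then show "continuous_map (subtopology (top_of_set {0..1}) {t \<in> topspace (top_of_set {0..1}). 1 / 2 \<le> t}) glued
          (\<lambda>t. P (Suc (2 * ix f)) (2 - 2 * t))"
        by (simp add: subtopology_subtopology Int_def conj_ac)
      show "P (2 * ix f) (2 * t) = P (Suc (2 * ix f)) (2 - 2 * t)" if "t = 1 / 2" for t
      proof -
        have "2 * t = 1" "2 - 2 * t = 1" using that by simp_all
        then show ?thesis using P_joint[OF ix(1)[OF f]] by simp
      qed
    qed (auto intro!: continuous_intros)
    then show "pathin glued (\<gamma> f)"
      unfolding pathin_def by (rule continuous_map_eq) (simp add: \<gamma>_def dart_def u_def)
    show "inj_on (\<gamma> f) {0..1}"
    proof (rule inj_onI)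
      fix t s :: real assume t: "t \<in> {0..1}" and s: "s \<in> {0..1}" and "\<gamma> f t = \<gamma> f s"
      then have "u t = u s \<and> (dart f t = dart f s \<or> u t = 0 \<and> vt (dart f t) = vt (dart f s)
          \<or> u t = 1 \<and> dart f t = mate (dart f s))"
        using P_eq[OF _ dart_less[OF f] dart_less[OF f]] u_range by (simp add: \<gamma>_def)
      \<comment> \<open>Both ends of the curve have \<open>u = 0\<close>; they are told apart
        because an edge has two different ends.\<close>
      moreover have "vt (2 * ix f) \<noteq> vt (Suc (2 * ix f))"
        using ix(3)[OF f] by (simp add: vt_def)
      ultimately show "t = s"
        by (auto simp: dart_def u_def split: if_splits)
    qed
    show "{\<gamma> f 0, \<gamma> f 1} = pt ` f"
      using arg_cong[OF ix(2)[OF f], of "image pt"]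
      by (simp add: \<gamma>_def dart_def u_def P_def pt_def seg0 vt_def)
    show "\<gamma> f ` {0<..<1} \<inter> pt ` V = {}"
      using P_pt u_pos by (force simp: \<gamma>_def)
  next
    fix f g assume fg: "f \<in> E" "g \<in> E" "f \<noteq> g"
    have "ix f \<noteq> ix g" using ix(2) fg by metis
    have "\<gamma> f t \<noteq> \<gamma> g s" if t: "0 < t" "t < 1" and s: "0 < s" "s < 1" for t s
    proof
      assume "\<gamma> f t = \<gamma> g s"
      then have "dart f t = dart g s \<or> u t = 0 \<or> dart f t = mate (dart g s)"
        using P_eq[OF _ dart_less[OF fg(1)] dart_less[OF fg(2)], of t "u t" s "u s"] u_range t s
        unfolding \<gamma>_def by (meson less_imp_le)
      then show False
        using u_pos[OF t] dart_div mate_dart_div \<open>ix f \<noteq> ix g\<close> by (metis less_irrefl)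
    qed
    then show "\<gamma> f ` {0<..<1} \<inter> \<gamma> g ` {0<..<1} = {}" by fastforce
  qed
  then show ?thesis
    using surface_glued sphere_with_handles_glued
    unfolding embeddable_in_genus_def has_euler_genus_def embeddable_def h_def by blast
qed

section \<open>A graph of girth 7 without (0,k)-coloring\<close>

text \<open>
  The Boolean selects one of two copies. In each copy, the path \<open>X i\<close>, \<open>M i j\<close>, \<open>Y j\<close> is
  an edge of a complete bipartite graph subdivided once, and the path \<open>X i\<close>, \<open>D i j\<close>, \<open>D j i\<close>,
  \<open>X j\<close> is an edge of a complete graph subdivided twice. The vertices \<open>D i i\<close> are harmless leaves.
  One edge joins \<open>X 0\<close> of the two copies.
\<close>

datatype vertex = X bool nat | Y bool nat | M bool nat nat | D bool nat nat

instance vertex :: countable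
  by countable_datatype

fun adj :: "vertex \<Rightarrow> vertex \<Rightarrow> bool" where
  "adj (X b i) (X b' i') \<longleftrightarrow> b \<noteq> b' \<and> i = 0 \<and> i' = 0"
| "adj (X b i) (M b' i' j) \<longleftrightarrow> b = b' \<and> i = i'"
| "adj (M b' i' j) (X b i) \<longleftrightarrow> b = b' \<and> i = i'"
| "adj (Y b j) (M b' i j') \<longleftrightarrow> b = b' \<and> j = j'"
| "adj (M b' i j') (Y b j) \<longleftrightarrow> b = b' \<and> j = j'"
| "adj (X b i) (D b' i' j) \<longleftrightarrow> b = b' \<and> i = i'"
| "adj (D b' i' j) (X b i) \<longleftrightarrow> b = b' \<and> i = i'"
| "adj (D b i j) (D b' i' j') \<longleftrightarrow> b = b' \<and> i = j' \<and> j = i' \<and> i \<noteq> j"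
| "adj _ _ \<longleftrightarrow> False"

fun in_range :: "nat \<Rightarrow> vertex \<Rightarrow> bool" where
  "in_range n (X b i) \<longleftrightarrow> i < n"
| "in_range n (Y b j) \<longleftrightarrow> j < n"
| "in_range n (M b i j) \<longleftrightarrow> i < n \<and> j < n"
| "in_range n (D b i j) \<longleftrightarrow> i < n \<and> j < n"

section \<open>Girth of the gadget graph\<close>

lemma adj_sym: "adj u v \<Longrightarrow> adj v u"
  by (cases u; cases v) auto

lemma adj_irrefl: "\<not> adj u u"
  by (cases u) auto

lemma no_3_cycle: "\<lbrakk>adj a b; adj b c; adj c a\<rbrakk> \<Longrightarrow> False"
  by (cases a; cases b; simp; cases c; simp)

text \<open>Adjacent vertices share indices, so following a short closed walk constructor by
  constructor ends in a contradiction or a repeated vertex.\<close>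

lemma no_4_cycle: "\<lbrakk>adj a b; adj b c; adj c d; adj d a; distinct [a, b, c, d]\<rbrakk> \<Longrightarrow> False"
  by (cases a; cases b; simp; cases c; simp; cases d; auto)

lemma no_5_cycle:
  "\<lbrakk>adj a b; adj b c; adj c d; adj d e; adj e a; distinct [a, b, c, d, e]\<rbrakk> \<Longrightarrow> False"
  by (cases a; cases b; simp; cases c; simp; cases d; simp; cases e; auto)

lemma no_6_cycle:
  "\<lbrakk>adj a b; adj b c; adj c d; adj d e; adj e f; adj f a; distinct [a, b, c, d, e, f]\<rbrakk> \<Longrightarrow> False"
  by (cases a; cases b; simp; cases c; simp; cases d; simp; cases e; simp; cases f; auto)

lemma finite_in_range: "finite {v. in_range n v}"
proof -
  have "{v. in_range n v} \<subseteq>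
      (\<lambda>(b, i). X b i) ` (UNIV \<times> {..<n}) \<union> (\<lambda>(b, j). Y b j) ` (UNIV \<times> {..<n}) \<union>
      (\<lambda>(b, i, j). M b i j) ` (UNIV \<times> {..<n} \<times> {..<n}) \<union>
      (\<lambda>(b, i, j). D b i j) ` (UNIV \<times> {..<n} \<times> {..<n})"
  proof
    fix v assume "v \<in> {v. in_range n v}"
    then show "v \<in> (\<lambda>(b, i). X b i) ` (UNIV \<times> {..<n}) \<union> (\<lambda>(b, j). Y b j) ` (UNIV \<times> {..<n}) \<union>
      (\<lambda>(b, i, j). M b i j) ` (UNIV \<times> {..<n} \<times> {..<n}) \<union>
      (\<lambda>(b, i, j). D b i j) ` (UNIV \<times> {..<n} \<times> {..<n})"
      by (cases v) (auto simp: image_iff)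
  qed
  then show ?thesis by (rule finite_subset) auto
qed

text \<open>The codes serve \<open>embeddable_in_genus\<close>, which speaks of graphs on
  \<open>nat\<close>.\<close>

definition gadget_vertices :: "nat \<Rightarrow> nat set" where
  "gadget_vertices n = to_nat ` {v. in_range n v}"

definition gadget_edges :: "nat \<Rightarrow> nat set set" where
  "gadget_edges n = {{to_nat u, to_nat v} | u v. in_range n u \<and> in_range n v \<and> adj u v}"

lemma edge_iff: "{to_nat u, to_nat v} \<in> gadget_edges n \<longleftrightarrow> in_range n u \<and> in_range n v \<and> adj u v"
  by (auto simp: gadget_edges_def doubleton_eq_iff intro: adj_sym)

lemma simple_graph_gadget: "simple_graph (gadget_vertices n) (gadget_edges n)"
  using finite_in_range adj_irrefl by (fastforce simp: simple_graph_def gadget_vertices_def gadget_edges_def)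

lemma girth_gadget: "girth_at_least 7 (gadget_edges n)"
  unfolding girth_at_least_def
proof
  assume "\<exists>xs. graph_cycle (gadget_edges n) xs \<and> length xs < 7"
  then obtain xs where len: "3 \<le> length xs" "length xs < 7" and "distinct xs"
    and edges: "\<And>i. i < length xs \<Longrightarrow> {xs ! i, xs ! (Suc i mod length xs)} \<in> gadget_edges n"
    by (auto simp: graph_cycle_def)
  \<comment> \<open>Each vertex of the cycle lies on an edge and is therefore a code, so the whole
    cycle can be decoded.\<close>
  have "x \<in> range (to_nat :: vertex \<Rightarrow> nat)" if "x \<in> set xs" for x
  proof -
    obtain i where "i < length xs" "x = xs ! i" using \<open>x \<in> set xs\<close> by (auto simp: in_set_conv_nth)
    then show ?thesis using edges[of i] by (auto simp: gadget_edges_def doubleton_eq_iff)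
  qed
  then obtain vs :: "vertex list" where vs: "xs = map to_nat vs"
    by (metis ex_map_conv image_iff)
  have adj: "adj (vs ! i) (vs ! (Suc i mod length vs))" if "i < length vs" for i
  proof -
    have "Suc i mod length vs < length vs" using that by (intro mod_less_divisor) auto
    then show ?thesis using edges[of i] that by (simp add: vs edge_iff)
  qed
  have "distinct vs" using \<open>distinct xs\<close> by (simp add: vs distinct_map)
  consider "length vs = 3" | "length vs = 4" | "length vs = 5" | "length vs = 6"
    using len vs by fastforce
  then show False
  proof cases
    case 1
    then obtain a b c where "vs = [a, b, c]" by (auto simp: numeral_eq_Suc length_Suc_conv)
    then show False using adj[of 0] adj[of 1] adj[of 2] no_3_cycle[of a b c] by simp
  next
    case 2
    then obtain a b c d where "vs = [a, b, c, d]" by (auto simp: numeral_eq_Suc length_Suc_conv)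
    then show False
      using adj[of 0] adj[of 1] adj[of 2] adj[of 3] no_4_cycle[of a b c d] \<open>distinct vs\<close> by simp
  next
    case 3
    then obtain a b c d e where "vs = [a, b, c, d, e]" by (auto simp: numeral_eq_Suc length_Suc_conv)
    then show False
      using adj[of 0] adj[of 1] adj[of 2] adj[of 3] adj[of 4] no_5_cycle[of a b c d e] \<open>distinct vs\<close> by simp
  next
    case 4
    then obtain a b c d e f where "vs = [a, b, c, d, e, f]" by (auto simp: numeral_eq_Suc length_Suc_conv)
    then show False
      using adj[of 0] adj[of 1] adj[of 2] adj[of 3] adj[of 4] adj[of 5] no_6_cycle[of a b c d e f]
        \<open>distinct vs\<close> by simp
  qed
qed

section \<open>Counting conflicts in a coloring\<close>

text \<open>
  \<open>A\<close> is the independent color class. The middle vertex of a once subdivided edge between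
  \<open>A\<close> and its complement lies outside \<open>A\<close> and counts against the end outside \<open>A\<close>; a twice subdivided
  edge with both ends outside \<open>A\<close> counts against at least one of them.
\<close>

lemma no_0_k_coloring:
  assumes n: "n = 3 * k + 3"
    and indep: "\<And>u v. \<lbrakk>in_range n u; in_range n v; adj u v; A u\<rbrakk> \<Longrightarrow> \<not> A v"
    and defect: "\<And>v. \<lbrakk>in_range n v; \<not> A v\<rbrakk> \<Longrightarrow> card {u. in_range n u \<and> adj u v \<and> \<not> A u} \<le> k"
  shows False
proof -
  have bound: "card J \<le> k"
    if v: "in_range n v" "\<not> A v" and f: "inj_on f J" "\<And>j. j \<in> J \<Longrightarrow> in_range n (f j) \<and> adj (f j) v \<and> \<not> A (f j)"
    for v and f :: "nat \<Rightarrow> vertex" and J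
  proof -
    have "finite {u. in_range n u \<and> adj u v \<and> \<not> A u}"
      using finite_in_range[of n] by (rule rev_finite_subset) auto
    then have "card J \<le> card {u. in_range n u \<and> adj u v \<and> \<not> A u}"
      using f by (intro card_inj_on_le[of f]) auto
    then show ?thesis using defect[OF v] by linarith
  qed
  have Y_bound: "card {j. j < n \<and> A (Y b j)} \<le> k" if "i < n" "\<not> A (X b i)" for b i
  proof (rule bound[of "X b i" "\<lambda>j. M b i j"])
    show "in_range n (M b i j) \<and> adj (M b i j) (X b i) \<and> \<not> A (M b i j)" if "j \<in> {j. j < n \<and> A (Y b j)}" for j
      using that indep[of "Y b j" "M b i j"] \<open>i < n\<close> by simp
  qed (use that in \<open>auto simp: inj_on_def\<close>)
  have X_bound: "card {i. i < n \<and> A (X b i)} \<le> k" if "j < n" "\<not> A (Y b j)" for b j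
  proof (rule bound[of "Y b j" "\<lambda>i. M b i j"])
    show "in_range n (M b i j) \<and> adj (M b i j) (Y b j) \<and> \<not> A (M b i j)" if "i \<in> {i. i < n \<and> A (X b i)}" for i
      using that indep[of "X b i" "M b i j"] \<open>j < n\<close> by simp
  qed (use that in \<open>auto simp: inj_on_def\<close>)
  obtain b where b: "\<not> A (X b 0)"
    using indep[of "X True 0" "X False 0"] n by auto
  have "\<exists>j<n. \<not> A (Y b j)"
  proof (rule ccontr)
    assume "\<not> ?thesis"
    then have "{j. j < n \<and> A (Y b j)} = {..<n}" by auto
    then show False using Y_bound[of 0 b] b n by simp
  qed
  then have X_few: "card {i. i < n \<and> A (X b i)} \<le> k" using X_bound by blast
  define B where "B = {i. i < n \<and> \<not> A (X b i)}"
  have "finite B" by (simp add: B_def)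
  have "card {..<n} = card ({i. i < n \<and> A (X b i)} \<union> B)"
    by (rule arg_cong[of _ _ card]) (auto simp: B_def)
  also have "\<dots> \<le> card {i. i < n \<and> A (X b i)} + card B" by (rule card_Un_le)
  finally have B_large: "2 * k + 3 \<le> card B" using X_few n by simp
  \<comment> \<open>\<open>R i\<close> indexes conflicts at \<open>X b i\<close>: neighbours
    \<open>D b i j\<close> outside \<open>A\<close> on the edges towards \<open>B\<close>.\<close>
  define R where "R i = {j \<in> B. i \<noteq> j \<and> \<not> A (D b i j)}" for i
  have R_bound: "card (R i) \<le> k" if "i \<in> B" for i
    by (rule bound[of "X b i" "\<lambda>j. D b i j"]) (use that in \<open>auto simp: inj_on_def R_def B_def\<close>)
  define P where "P = Sigma B R"
  have "finite P" using \<open>finite B\<close> by (auto simp: P_def R_def)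
  have "card P = (\<Sum>i\<in>B. card (R i))"
    using \<open>finite B\<close> by (auto simp: P_def R_def)
  also have "\<dots> \<le> card B * k"
    using sum_bounded_above[of B "\<lambda>i. card (R i)" k] R_bound by simp
  finally have "card P \<le> card B * k" .
  \<comment> \<open>\<open>D b i j\<close> and \<open>D b j i\<close> are adjacent, so they are not
    both in \<open>A\<close>: each off-diagonal pair is a conflict in at least one order. The
    diagonal causes the \<open>+ 1\<close> in \<open>2 * k + 1\<close> below.\<close>
  have "p \<in> P \<union> P\<inverse> \<union> Id_on B" if "p \<in> B \<times> B" for p
  proof -
    obtain i j where p: "p = (i, j)" "i \<in> B" "j \<in> B" using \<open>p \<in> B \<times> B\<close> by auto
    then have "(i, j) \<in> P \<or> (j, i) \<in> P \<or> i = j"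
      using indep[of "D b i j" "D b j i"] by (auto simp: P_def R_def B_def)
    then show ?thesis using p by auto
  qed
  then have "B \<times> B \<subseteq> P \<union> P\<inverse> \<union> Id_on B" by blast
  then have "card (B \<times> B) \<le> card (P \<union> P\<inverse> \<union> Id_on B)"
    using \<open>finite P\<close> \<open>finite B\<close> by (intro card_mono) (auto simp: Id_on_def)
  also have "\<dots> \<le> card P + card (P\<inverse>) + card (Id_on B)"
    by (meson card_Un_le order_trans add_right_mono)
  also have "card (Id_on B) = card B"
  proof -
    have "Id_on B = (\<lambda>i. (i, i)) ` B" by auto
    then show ?thesis by (simp add: card_image inj_on_def)
  qed
  finally have "card B * card B \<le> card B * k + card B * k + card B"
    using \<open>card P \<le> card B * k\<close> by (simp add: card_cartesian_product)
  then have "card B * card B \<le> card B * (2 * k + 1)" by (simp add: algebra_simps)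
  moreover have "card B * (2 * k + 1) < card B * card B"
    using B_large by (intro mult_strict_left_mono) auto
  ultimately show False by linarith
qed

text \<open>An inequality for \<open>d\<close> is the right form, since the floor in the theorem
  will only be bounded from above.\<close>

lemma gadget_not_colorable:
  assumes "d \<le> int k"
  shows "\<not> improper_coloring [0, d] (gadget_vertices (3 * k + 3)) (gadget_edges (3 * k + 3)) col"
proof
  define n where "n = 3 * k + 3"
  assume "improper_coloring [0, d] (gadget_vertices (3 * k + 3)) (gadget_edges (3 * k + 3)) col"
  then have col: "col (to_nat v) < 2 \<and>
      int (card {u \<in> gadget_vertices n. {u, to_nat v} \<in> gadget_edges n \<and> col u = col (to_nat v)}) \<le> [0, d] ! col (to_nat v)"
    if "in_range n v" for v
    using that unfolding improper_coloring_def n_def[symmetric] by (auto simp: gadget_vertices_def numeral_2_eq_2)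
  have nbrs: "{u \<in> gadget_vertices n. {u, to_nat v} \<in> gadget_edges n \<and> col u = col (to_nat v)} =
      to_nat ` {u. in_range n u \<and> adj u v \<and> col (to_nat u) = col (to_nat v)}" if "in_range n v" for v
    using that by (auto simp: gadget_vertices_def edge_iff)
  have card_nbrs: "card {u \<in> gadget_vertices n. {u, to_nat v} \<in> gadget_edges n \<and> col u = col (to_nat v)} =
      card {u. in_range n u \<and> adj u v \<and> col (to_nat u) = col (to_nat v)}" if "in_range n v" for v
    unfolding nbrs[OF that] by (intro card_image) simp
  show False
  proof (rule no_0_k_coloring[OF n_def, of "\<lambda>v. col (to_nat v) = 0"])
    fix u v assume *: "in_range n u" "in_range n v" "adj u v" "col (to_nat u) = 0"
    show "col (to_nat v) \<noteq> 0"
    proof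
      assume "col (to_nat v) = 0"
      then have "card {u. in_range n u \<and> adj u v \<and> col (to_nat u) = col (to_nat v)} = 0"
        using col[OF *(2)] card_nbrs[OF *(2)] by simp
      moreover have "finite {u. in_range n u \<and> adj u v \<and> col (to_nat u) = col (to_nat v)}"
        using finite_in_range[of n] by (rule rev_finite_subset) auto
      ultimately show False using * \<open>col (to_nat v) = 0\<close> by auto
    qed
  next
    fix v assume v: "in_range n v" "col (to_nat v) \<noteq> 0"
    then have "col (to_nat v) = 1" using col by fastforce
    moreover have "col (to_nat u) \<noteq> 0 \<longleftrightarrow> col (to_nat u) = 1" if "in_range n u" for u
      using col[OF that] by linarith
    ultimately have "{u. in_range n u \<and> adj u v \<and> col (to_nat u) \<noteq> 0} =
        {u. in_range n u \<and> adj u v \<and> col (to_nat u) = col (to_nat v)}" by auto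
    then show "card {u. in_range n u \<and> adj u v \<and> col (to_nat u) \<noteq> 0} \<le> k"
      using col[OF v(1)] card_nbrs[OF v(1)] \<open>col (to_nat v) = 1\<close> assms by simp
  qed
qed

section \<open>Edge counts and the constant\<close>

lemma adj_cases:
  assumes "adj u v" "in_range n u" "in_range n v"
  shows "\<exists>b i j. i < n \<and> j < n \<and> ({u, v} = {M b i j, X b i} \<or> {u, v} = {M b i j, Y b j} \<or>
    {u, v} = {D b i j, X b i} \<or> {u, v} = {D b i j, D b j i} \<or> {u, v} = {X b i, X (\<not> b) i})"
  using assms by (cases u; cases v) (auto simp: doubleton_eq_iff)

text \<open>Five kinds of edges, each indexed by one of two copies and a pair \<open>(i, j)\<close>,
  give the factor 10; edges listed repeatedly do no harm.\<close>

lemma card_gadget_edges_le: "card (gadget_edges n) \<le> 10 * n\<^sup>2"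
proof -
  let ?S = "(UNIV :: bool set) \<times> {..<n} \<times> {..<n}"
  define F :: "nat \<Rightarrow> bool \<times> nat \<times> nat \<Rightarrow> vertex set" where
    "F t = (\<lambda>(b, i, j). if t = 0 then {M b i j, X b i} else if t = 1 then {M b i j, Y b j}
       else if t = 2 then {D b i j, X b i} else if t = 3 then {D b i j, D b j i}
       else {X b i, X (\<not> b) i})" for t
  have "gadget_edges n \<subseteq> (\<lambda>(t, s). to_nat ` F t s) ` ({..<5} \<times> ?S)"
  proof
    fix e assume "e \<in> gadget_edges n"
    then obtain u v where e: "e = to_nat ` {u, v}" and uv: "adj u v" "in_range n u" "in_range n v"
      by (auto simp: gadget_edges_def)
    obtain b i j where ij: "i < n" "j < n" and
      "{u, v} = {M b i j, X b i} \<or> {u, v} = {M b i j, Y b j} \<or>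
       {u, v} = {D b i j, X b i} \<or> {u, v} = {D b i j, D b j i} \<or> {u, v} = {X b i, X (\<not> b) i}"
      using adj_cases[OF uv] by blast
    then have "{u, v} = F 0 (b, i, j) \<or> {u, v} = F 1 (b, i, j) \<or> {u, v} = F 2 (b, i, j)
        \<or> {u, v} = F 3 (b, i, j) \<or> {u, v} = F 4 (b, i, j)"
      by (simp add: F_def)
    then obtain t where "t < 5" "{u, v} = F t (b, i, j)"
      by (elim disjE) (erule that[rotated], simp)+
    then show "e \<in> (\<lambda>(t, s). to_nat ` F t s) ` ({..<5} \<times> ?S)"
      using ij e by (intro image_eqI[of _ _ "(t, b, i, j)"]) auto
  qed
  then have "card (gadget_edges n) \<le> card ({..<5::nat} \<times> ?S)"
    by (intro surj_card_le) auto
  then show ?thesis by (simp add: card_cartesian_product power2_eq_square card_UNIV_bool)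
qed

text \<open>The edges from \<open>X True 0\<close> to its vertices \<open>M True 0 j\<close>
  suffice: a linear bound already makes the genera unbounded.\<close>

lemma card_gadget_edges_ge: "n \<le> card (gadget_edges n)"
proof -
  have "finite (gadget_edges n)"
    using finite_subset[of "gadget_edges n" "Pow (gadget_vertices n)"] finite_in_range by (auto simp: gadget_edges_def gadget_vertices_def)
  moreover have "inj_on (\<lambda>j. {to_nat (X True 0), to_nat (M True 0 j)}) {..<n}"
    by (auto simp: inj_on_def doubleton_eq_iff)
  moreover have "(\<lambda>j. {to_nat (X True 0), to_nat (M True 0 j)}) ` {..<n} \<subseteq> gadget_edges n"
    by (auto simp: edge_iff)
  ultimately have "card {..<n} \<le> card (gadget_edges n)" by (intro card_inj_on_le)
  then show ?thesis by simp
qed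

theorem mainTheorem12:
  shows "\<exists>c::real. c > 0 \<and>
    infinite {g::nat. g > 0 \<and>
      (\<exists>(V :: nat set) (E :: nat set set).
         simple_graph V E \<and> girth_at_least 7 E \<and> embeddable_in_genus V E g \<and>
         \<not> (\<exists>col. improper_coloring [0, \<lfloor>c * sqrt (real g)\<rfloor>] V E col))}"
proof (intro exI[of _ "1 / 14"] conjI)
  let ?G = "{g::nat. g > 0 \<and>
      (\<exists>(V :: nat set) (E :: nat set set).
         simple_graph V E \<and> girth_at_least 7 E \<and> embeddable_in_genus V E g \<and>
         \<not> (\<exists>col. improper_coloring [0, \<lfloor>1 / 14 * sqrt (real g)\<rfloor>] V E col))}"
  have "\<exists>g>k. g \<in> ?G" for k
  proof -
    define n where "n = 3 * k + 3"
    define g where "g = 2 * card (gadget_edges n)"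
    have "k < g" using card_gadget_edges_ge[of n] by (simp add: g_def n_def)
    have "g \<le> 20 * n\<^sup>2" using card_gadget_edges_le[of n] by (simp add: g_def)
    also have "\<dots> = 180 * (k + 1)\<^sup>2" by (simp add: n_def power2_eq_square algebra_simps)
    \<comment> \<open>14 is the least integer whose square exceeds 180, whence the constant
      \<open>1 / 14\<close>. The strict inequality puts the floor at most at \<open>k\<close>, not
      \<open>k + 1\<close>.\<close>
    also have "\<dots> < 196 * (k + 1)\<^sup>2" by simp
    also have "\<dots> = (14 * (k + 1))\<^sup>2" by (simp add: power2_eq_square algebra_simps)
    finally have "real g < real ((14 * (k + 1))\<^sup>2)" by (simp only: of_nat_less_iff)
    then have "real g < (14 * (real k + 1))\<^sup>2" by (simp add: add.commute)
    then have "sqrt (real g) < 14 * (real k + 1)" by (intro real_less_lsqrt) auto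
    then have "\<lfloor>1 / 14 * sqrt (real g)\<rfloor> \<le> int k" by (simp add: floor_le_iff)
    then have "\<not> (\<exists>col. improper_coloring [0, \<lfloor>1 / 14 * sqrt (real g)\<rfloor>] (gadget_vertices n) (gadget_edges n) col)"
      using gadget_not_colorable unfolding n_def by blast
    moreover have "embeddable_in_genus (gadget_vertices n) (gadget_edges n) g"
      unfolding g_def by (rule embeddable_in_genus_twice_card[OF simple_graph_gadget])
    moreover have "0 < g" using \<open>k < g\<close> by simp
    ultimately have "g \<in> ?G"
      using simple_graph_gadget girth_gadget by blast
    then show ?thesis using \<open>k < g\<close> by blast
  qed
  then show "infinite ?G" by (simp add: infinite_nat_iff_unbounded)
qed simp

end
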